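(* Let $(X,\mathcal{A},\mu)$ be a measure space with $\mu(X)>0$ such that $X$ is not an atom, and let $f\in\mathscr{D}$ be a vertex of the comaximal graph $\Gamma'_2(\mathcal{M}(X,\mathcal{A}))$. Then the eccentricity of $f$ in $\Gamma'_2(\mathcal{M}(X,\mathcal{A}))$ is $$ecc(f)=\begin{cases}2&\text{if }Z(f)\text{ is an atom},\\ 3&\text{otherwise.}\end{cases}$$
   Context: $\mathcal{M}(X,\mathcal{A})$ is the commutative ring (pointwise operations) of all $\mathcal{A}$-measurable functions $f:X\to\mathbb{R}$; $Z(f)=\{x\in X:f(x)=0\}$. A set $A\in\mathcal{A}$ is an atom if $\mu(A)>0$ and $A$ cannot be written as a disjoint union $A=B\sqcup C$ with $B,C\in\mathcal{A}$, $\mu(B)>0$, $\mu(C)>0$. A function $u\in\mathcal{M}(X,\mathcal{A})$ is a $\mu$-unit if $\mu(Z(u))=0$. Write $\mathscr{D}=\{f\in\mathcal{M}(X,\mathcal{A}):\mu(Z(f))>0\text{ and }\mu(X\setminus Z(f))>0\}$, i.e. the functions that are neither $\mu$-units nor equal to $0$ almost everywhere. The comaximal graph $\Gamma'_2(\mathcal{M}(X,\mathcal{A}))$ is the simple graph with vertex set $\mathscr{D}$ in which distinct $f,g$ are adjacent iff the sum of principal ideals $\langle f\rangle+\langle g\rangle$ equals $\langle u\rangle$ for some $\mu$-unit $u$. $d(f,g)$ is the length of a shortest path joining $f$ and $g$, and $ecc(f)=\max\{d(f,g):g\in\mathscr{D}\}$. *)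

theory Defs
  imports
    "HOL-Analysis.Analysis"
    "HOL-Algebra.Ideal"
    "HOL-Library.Extended_Nat"
    "Graph_Theory.Pair_Digraph"
    "Graph_Theory.Shortest_Path"
begin

section \<open>The ring of measurable functions\<close>

text \<open>
  The space of a measure may be a proper subset of the underlying type. Functions on it are
  represented by the extensional ones, so that equality of vertices is equality of functions
  on \<open>space M\<close>.
\<close>

definition measurable_ring :: "'a measure \<Rightarrow> ('a \<Rightarrow> real) ring" where
  "measurable_ring M =
     \<lparr> carrier = borel_measurable M \<inter> extensional (space M),
       mult = (\<lambda>f g. \<lambda>x\<in>space M. f x * g x),
       one = (\<lambda>x\<in>space M. 1),
       zero = (\<lambda>x\<in>space M. 0),
       add = (\<lambda>f g. \<lambda>x\<in>space M. f x + g x) \<rparr>"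

definition zero_set :: "'a measure \<Rightarrow> ('a \<Rightarrow> real) \<Rightarrow> 'a set" where
  "zero_set M f = {x \<in> space M. f x = 0}"

definition mu_unit :: "'a measure \<Rightarrow> ('a \<Rightarrow> real) \<Rightarrow> bool" where
  "mu_unit M u \<longleftrightarrow> u \<in> carrier (measurable_ring M) \<and> emeasure M (zero_set M u) = 0"

definition measure_atom :: "'a measure \<Rightarrow> 'a set \<Rightarrow> bool" where
  "measure_atom M A \<longleftrightarrow> A \<in> sets M \<and> emeasure M A > 0 \<and>
     \<not> (\<exists>B\<in>sets M. \<exists>C\<in>sets M. A = B \<union> C \<and> B \<inter> C = {} \<and> emeasure M B > 0 \<and> emeasure M C > 0)"

lemma measurable_ring_cring: "cring (measurable_ring M)"
proof (rule cringI)
  show "abelian_group (measurable_ring M)"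
  proof (rule abelian_groupI)
    fix f assume f: "f \<in> carrier (measurable_ring M)"
    show "\<exists>g\<in>carrier (measurable_ring M). g \<oplus>\<^bsub>measurable_ring M\<^esub> f = \<zero>\<^bsub>measurable_ring M\<^esub>"
      by (rule bexI[of _ "\<lambda>x\<in>space M. - f x"])
        (use f in \<open>auto simp: measurable_ring_def restrict_def extensional_def cong: measurable_cong\<close>)
  qed (auto simp: measurable_ring_def restrict_def extensional_def fun_eq_iff algebra_simps
         cong: measurable_cong)
  show "Group.comm_monoid (measurable_ring M)"
    by (rule comm_monoidI)
      (auto simp: measurable_ring_def restrict_def extensional_def fun_eq_iff algebra_simps
         cong: measurable_cong)
qed (auto simp: measurable_ring_def restrict_def extensional_def fun_eq_iff algebra_simps
       cong: measurable_cong)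


section \<open>The comaximal graph\<close>

definition comaximal_verts :: "'a measure \<Rightarrow> ('a \<Rightarrow> real) set" where
  "comaximal_verts M =
     {f \<in> carrier (measurable_ring M).
        emeasure M (zero_set M f) > 0 \<and> emeasure M (space M - zero_set M f) > 0}"

text \<open>
  A simple graph is represented as a loop-free symmetric digraph: each edge gives the two arcs
  between its end points.
\<close>

definition comaximal_graph :: "'a measure \<Rightarrow> ('a \<Rightarrow> real) pair_pre_digraph" where
  "comaximal_graph M =
     \<lparr> pverts = comaximal_verts M,
       parcs = {(f, g). f \<in> comaximal_verts M \<and> g \<in> comaximal_verts M \<and> f \<noteq> g \<and>
         (\<exists>u. mu_unit M u \<and>
            PIdl\<^bsub>measurable_ring M\<^esub> f <+>\<^bsub>measurable_ring M\<^esub> PIdl\<^bsub>measurable_ring M\<^esub> g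
              = PIdl\<^bsub>measurable_ring M\<^esub> u)} \<rparr>"

lemma comaximal_graph_simple: "pair_bidirected_digraph (comaximal_graph M)"
proof -
  interpret R: cring "measurable_ring M" by (rule measurable_ring_cring)
  have car: "f \<in> carrier (measurable_ring M)" if "f \<in> comaximal_verts M" for f
    using that by (simp add: comaximal_verts_def)
  have comm: "PIdl\<^bsub>measurable_ring M\<^esub> f <+>\<^bsub>measurable_ring M\<^esub> PIdl\<^bsub>measurable_ring M\<^esub> g
      = PIdl\<^bsub>measurable_ring M\<^esub> g <+>\<^bsub>measurable_ring M\<^esub> PIdl\<^bsub>measurable_ring M\<^esub> f"
    if "f \<in> comaximal_verts M" "g \<in> comaximal_verts M" for f g
    by (rule R.set_add_comm; rule additive_subgroup.a_subset[OF ideal.axioms(1)];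
        rule R.cgenideal_ideal; rule car; rule that)
  show ?thesis
    by unfold_locales
      (auto simp: comaximal_graph_def symmetric_def sym_def comm)
qed


section \<open>Distance and eccentricity\<close>

text \<open>The distance is \<open>\<infinity>\<close> if the two vertices are not joined by a path.\<close>

definition graph_dist :: "('v, 'e) pre_digraph \<Rightarrow> 'v \<Rightarrow> 'v \<Rightarrow> enat" where
  "graph_dist G u v = (INF p\<in>{p. pre_digraph.apath G u p v}. enat (length p))"

text \<open>
  The supremum in \<^typ>\<open>enat\<close> is the maximum whenever it is finite and there is a vertex; see
  \<open>eccentricity_eq_enat_iff\<close> below.
\<close>

definition eccentricity :: "('v, 'e) pre_digraph \<Rightarrow> 'v \<Rightarrow> enat" where
  "eccentricity G u = (SUP v\<in>verts G. graph_dist G u v)"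

lemma eccentricity_eq_enat_iff:
  assumes "verts G \<noteq> {}"
  shows "eccentricity G u = enat n \<longleftrightarrow>
    (\<exists>v\<in>verts G. graph_dist G u v = enat n) \<and> (\<forall>v\<in>verts G. graph_dist G u v \<le> enat n)"
proof
  assume e: "eccentricity G u = enat n"
  let ?A = "graph_dist G u ` verts G"
  have fin: "finite ?A" 
    using e assms by (auto simp: eccentricity_def Sup_enat_def split: if_splits)
  then have "Max ?A = enat n"
    using e assms by (auto simp: eccentricity_def Sup_enat_def split: if_splits)
  then have "enat n \<in> ?A" "\<forall>x\<in>?A. x \<le> enat n"
    using Max_in[OF fin] Max_ge[OF fin] assms by auto
  then show "(\<exists>v\<in>verts G. graph_dist G u v = enat n) \<and> (\<forall>v\<in>verts G. graph_dist G u v \<le> enat n)"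
    by (metis (no_types, lifting) image_iff)
next
  assume "(\<exists>v\<in>verts G. graph_dist G u v = enat n) \<and> (\<forall>v\<in>verts G. graph_dist G u v \<le> enat n)"
  then show "eccentricity G u = enat n"
    unfolding eccentricity_def by (metis SUP_upper SUP_least antisym)
qed

lemma (in wf_digraph) graph_dist_eq_mu:
  "ereal_of_enat (graph_dist G u v) = \<mu> (\<lambda>_. 1) u v"
proof (cases "\<exists>p. apath u p v")
  case False
  then have a: "{p. apath u p v} = {}" "{p. awalk u p v} = {}"
    using apath_awalk_to_apath by auto
  show ?thesis
    unfolding graph_dist_def \<mu>_def a by (simp add: top_enat_def top_ereal_def)
next
  case True
  then obtain p where p: "apath u p v" and least: "\<And>q. apath u q v \<Longrightarrow> length p \<le> length q"
    using ex_has_least_nat[of "\<lambda>p. apath u p v" _ length] by blast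
  have cost: "awalk_cost (\<lambda>_. 1) q = real (length q)" for q :: "'b list"
    by (induct q) auto
  have "graph_dist G u v = enat (length p)"
    unfolding graph_dist_def using p least by (intro antisym INF_lower INF_greatest) auto
  moreover have "\<mu> (\<lambda>_. 1) u v = ereal (real (length p))"
  proof (rule antisym)
    have "awalk u p v" using p by (rule awalkI_apath)
    then show "\<mu> (\<lambda>_. 1) u v \<le> ereal (real (length p))"
      unfolding \<mu>_def cost by (intro INF_lower) simp
    have "length p \<le> length q" if q: "awalk u q v" for q
    proof -
      have "awalk_cost (\<lambda>_. 1) (awalk_to_apath q) \<le> awalk_cost (\<lambda>_. 1) q"
        using q by (rule awalk_to_path_no_neg_cyc_cost) (simp add: cost)
      then show ?thesis
        using least[OF apath_awalk_to_apath[OF q]] by (simp add: cost)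
    qed
    then show "ereal (real (length p)) \<le> \<mu> (\<lambda>_. 1) u v"
      unfolding \<mu>_def cost by (intro INF_greatest) simp
  qed
  ultimately show ?thesis by simp
qed

end

theory Submission
  imports Defs
begin

text \<open>
  Two functions \<open>f\<close> and \<open>g\<close> are comaximal iff \<open>Z(f) \<inter> Z(g)\<close> is null, as
  \<open>f\<^sup>2 + g\<^sup>2\<close> generates \<open>\<langle>f\<rangle> + \<langle>g\<rangle>\<close>. Indicator functions realise every measurable zero set. So
  \<open>f\<close> and \<open>g\<close> have a common neighbour iff \<open>Z(f) \<union> Z(g)\<close> is not conull, and if it is conull, then
  the indicators of \<open>Z(f)\<close> and \<open>Z(g)\<close> are adjacent, which joins \<open>f\<close> to \<open>g\<close> in three steps.
  If \<open>Z(f)\<close> is an atom and \<open>f\<close>, \<open>g\<close> are not adjacent, then \<open>Z(f) \<subseteq> Z(g)\<close> up to a null set, so a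
  common neighbour exists, while \<open>2f\<close> is not adjacent to \<open>f\<close>. If \<open>Z(f)\<close> splits into
  \<open>B\<close> and \<open>C\<close> of positive measure, then the indicator of \<open>C\<close> is at distance \<open>3\<close>.
\<close>

section \<open>Sums of principal ideals and common zero sets\<close>

text \<open>A combination of \<open>f\<close> and \<open>g\<close> always lies in the sum of their
  ideals; \<open>c\<close> and \<open>d\<close> witness that it divides both generators, which gives
  the other inclusion.\<close>

lemma (in cring) cgenideal_sum_eq_cgenideal:
  assumes "f \<in> carrier R" "g \<in> carrier R" "a \<in> carrier R" "b \<in> carrier R"
    and c: "c \<in> carrier R" "f = c \<otimes> (a \<otimes> f \<oplus> b \<otimes> g)"
    and d: "d \<in> carrier R" "g = d \<otimes> (a \<otimes> f \<oplus> b \<otimes> g)"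
  shows "PIdl f <+> PIdl g = PIdl (a \<otimes> f \<oplus> b \<otimes> g)" (is "_ = PIdl ?u")
proof
  have u: "?u \<in> carrier R" using assms(1-4) by simp
  interpret U: ideal "PIdl ?u" R by (rule cgenideal_ideal[OF u])
  have "f \<in> PIdl ?u" "g \<in> PIdl ?u"
    using c d unfolding cgenideal_def by blast+
  then have "PIdl f \<subseteq> PIdl ?u" "PIdl g \<subseteq> PIdl ?u"
    by (simp_all only: cgenideal_minimal[OF U.ideal_axioms])
  then show "PIdl f <+> PIdl g \<subseteq> PIdl ?u"
    by (auto simp: set_add_def' intro!: U.a_closed)
  show "PIdl ?u \<subseteq> PIdl f <+> PIdl g"
  proof (rule cgenideal_minimal)
    show "ideal (PIdl f <+> PIdl g) R"
      by (intro add_ideals cgenideal_ideal assms)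
    have "a \<otimes> f \<in> PIdl f" "b \<otimes> g \<in> PIdl g"
      using assms(3,4) unfolding cgenideal_def by blast+
    then show "?u \<in> PIdl f <+> PIdl g"
      unfolding set_add_def' by blast
  qed
qed

lemma carrier_measurable_ring:
  "carrier (measurable_ring M) = borel_measurable M \<inter> extensional (space M)"
  by (simp add: measurable_ring_def)

lemma sets_zero_set [measurable]:
  "f \<in> carrier (measurable_ring M) \<Longrightarrow> zero_set M f \<in> sets M"
proof -
  assume "f \<in> carrier (measurable_ring M)"
  then have [measurable]: "f \<in> borel_measurable M"
    by (simp add: carrier_measurable_ring)
  show ?thesis
    unfolding zero_set_def by (intro borel_measurable_eq borel_measurable_const) fact
qed

text \<open>A generator of the ideal sum is a combination of \<open>f\<close> and \<open>g\<close>,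
  so it vanishes wherever both do, and a \<open>mu_unit\<close> vanishes only on a null set.
  Conversely, the sum of squares vanishes only on the common zeros and divides both functions
  pointwise.\<close>

lemma comaximal_iff_null_inter:
  assumes f: "f \<in> carrier (measurable_ring M)" and g: "g \<in> carrier (measurable_ring M)"
  shows "(\<exists>u. mu_unit M u \<and>
      PIdl\<^bsub>measurable_ring M\<^esub> f <+>\<^bsub>measurable_ring M\<^esub> PIdl\<^bsub>measurable_ring M\<^esub> g
        = PIdl\<^bsub>measurable_ring M\<^esub> u)
    \<longleftrightarrow> emeasure M (zero_set M f \<inter> zero_set M g) = 0" (is "?L \<longleftrightarrow> ?R")
proof -
  interpret R: cring "measurable_ring M" by (rule measurable_ring_cring)
  show ?thesis
  proof
    assume ?L
    then obtain u where u: "u \<in> carrier (measurable_ring M)" "emeasure M (zero_set M u) = 0"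
      and eq: "PIdl\<^bsub>measurable_ring M\<^esub> f <+>\<^bsub>measurable_ring M\<^esub> PIdl\<^bsub>measurable_ring M\<^esub> g
        = PIdl\<^bsub>measurable_ring M\<^esub> u"
      unfolding mu_unit_def by blast
    have "u \<in> PIdl\<^bsub>measurable_ring M\<^esub> f <+>\<^bsub>measurable_ring M\<^esub> PIdl\<^bsub>measurable_ring M\<^esub> g"
      unfolding eq by (rule R.cgenideal_self[OF u(1)])
    then obtain a b where
      "u = a \<otimes>\<^bsub>measurable_ring M\<^esub> f \<oplus>\<^bsub>measurable_ring M\<^esub> b \<otimes>\<^bsub>measurable_ring M\<^esub> g"
      by (auto simp: set_add_def' cgenideal_def)
    then have "zero_set M f \<inter> zero_set M g \<subseteq> zero_set M u"
      by (auto simp: measurable_ring_def zero_set_def)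
    then show ?R
      by (rule emeasure_eq_0[OF sets_zero_set[OF u(1)] u(2)])
  next
    assume null: ?R
    define u where "u = f \<otimes>\<^bsub>measurable_ring M\<^esub> f \<oplus>\<^bsub>measurable_ring M\<^esub> g \<otimes>\<^bsub>measurable_ring M\<^esub> g"
    have u: "u = (\<lambda>x\<in>space M. f x * f x + g x * g x)"
      by (auto simp: u_def measurable_ring_def)
    have uc: "u \<in> carrier (measurable_ring M)"
      using f g by (simp add: u_def)
    have "zero_set M u = zero_set M f \<inter> zero_set M g"
      by (auto simp: zero_set_def u sum_squares_eq_zero_iff)
    with null uc have unit: "mu_unit M u" by (simp add: mu_unit_def)
    \<comment> \<open>Where \<open>u\<close> is 0, both \<open>f\<close> and \<open>g\<close> are 0,
      so the quotient, which has value 0 there by the convention \<open>h x / 0 = 0\<close>, still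
      multiplies back to \<open>h\<close>.\<close>
    have dvd: "h = (\<lambda>x\<in>space M. h x / u x) \<otimes>\<^bsub>measurable_ring M\<^esub> u \<and>
        (\<lambda>x\<in>space M. h x / u x) \<in> carrier (measurable_ring M)"
      if h: "h = f \<or> h = g" for h
    proof
      have "h \<in> carrier (measurable_ring M)" using h f g by auto
      then show "(\<lambda>x\<in>space M. h x / u x) \<in> carrier (measurable_ring M)"
        using uc by (auto simp: carrier_measurable_ring cong: measurable_cong)
      show "h = (\<lambda>x\<in>space M. h x / u x) \<otimes>\<^bsub>measurable_ring M\<^esub> u"
      proof
        fix x
        show "h x = ((\<lambda>x\<in>space M. h x / u x) \<otimes>\<^bsub>measurable_ring M\<^esub> u) x"
        proof (cases "x \<in> space M")
          case True
          then have "u x = 0 \<Longrightarrow> h x = 0"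
            using h by (auto simp: u sum_squares_eq_zero_iff)
          with True show ?thesis by (simp add: measurable_ring_def)
        next
          case False
          with \<open>h \<in> carrier (measurable_ring M)\<close> show ?thesis
            by (simp add: measurable_ring_def extensional_def)
        qed
      qed
    qed
    have "PIdl\<^bsub>measurable_ring M\<^esub> f <+>\<^bsub>measurable_ring M\<^esub> PIdl\<^bsub>measurable_ring M\<^esub> g
        = PIdl\<^bsub>measurable_ring M\<^esub> u"
      \<comment> \<open>The second pair \<open>f g\<close> supplies the coefficients, so the
        combination is the sum of squares \<open>u\<close>.\<close>
      by (rule R.cgenideal_sum_eq_cgenideal[OF f g f g, folded u_def,
            OF conjunct2[OF dvd] conjunct1[OF dvd] conjunct2[OF dvd] conjunct1[OF dvd]]) simp_all
    with unit show ?L by blast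
  qed
qed

section \<open>Arcs and vertices in terms of zero sets\<close>

lemma comaximal_arc_iff:
  "(f, g) \<in> parcs (comaximal_graph M) \<longleftrightarrow> f \<in> comaximal_verts M \<and> g \<in> comaximal_verts M \<and>
     emeasure M (zero_set M f \<inter> zero_set M g) = 0"
proof (cases "f \<in> comaximal_verts M \<and> g \<in> comaximal_verts M")
  case True
  then have car: "f \<in> carrier (measurable_ring M)" "g \<in> carrier (measurable_ring M)"
    by (simp_all add: comaximal_verts_def)
  \<comment> \<open>For \<open>f = g\<close> the intersection would be the zero set of a vertex,
    which has positive measure.\<close>
  have "f \<noteq> g" if "emeasure M (zero_set M f \<inter> zero_set M g) = 0"
    using that True by (auto simp: comaximal_verts_def)
  then show ?thesis
    unfolding comaximal_graph_def pair_pre_digraph.simps mem_Collect_eq prod.case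
      comaximal_iff_null_inter[OF car]
    by blast
next
  case False
  then show ?thesis by (auto simp: comaximal_graph_def)
qed

lemma pverts_comaximal_graph: "pverts (comaximal_graph M) = comaximal_verts M"
  by (simp add: comaximal_graph_def)

lemma zero_set_indicator:
  "zero_set M (\<lambda>x\<in>space M. indicator A x) = space M - A"
  by (auto simp: zero_set_def indicator_def)

lemma indicator_in_comaximal_verts:
  assumes "A \<in> sets M" "emeasure M A > 0" "emeasure M (space M - A) > 0"
  shows "(\<lambda>x\<in>space M. indicator A x) \<in> comaximal_verts M"
proof -
  have "space M - (space M - A) = A"
    using sets.sets_into_space[OF assms(1)] by blast
  with assms show ?thesis
    by (auto simp: comaximal_verts_def zero_set_indicator carrier_measurable_ring
        cong: measurable_cong)
qed

section \<open>Common neighbours and bounds on the distance\<close>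

text \<open>\<open>graph_dist\<close> ranges over paths without repeated vertices, whereas
  \<open>\<mu>\<close> ranges over all walks. Going through \<open>\<mu>\<close> lets explicit walks
  serve as upper bounds even if some of their vertices coincide.\<close>

lemma (in wf_digraph) graph_dist_le_length:
  assumes "awalk u p v"
  shows "graph_dist G u v \<le> enat (length p)"
proof -
  have cost: "awalk_cost (\<lambda>_. 1) q = real (length q)" for q :: "'b list"
    by (induct q) auto
  have "\<mu> (\<lambda>_. 1) u v \<le> ereal (real (length p))"
    unfolding \<mu>_def cost using assms by (intro INF_lower) simp
  then have "ereal_of_enat (graph_dist G u v) \<le> ereal_of_enat (enat (length p))"
    by (simp add: graph_dist_eq_mu)
  then show ?thesis by (simp only: ereal_of_enat_le_iff)
qed

lemma wf_digraph_comaximal: "wf_digraph (with_proj (comaximal_graph M))"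
proof -
  interpret pair_bidirected_digraph "comaximal_graph M"
    by (rule comaximal_graph_simple)
  show ?thesis by unfold_locales
qed

context
  fixes M :: "'a measure"
begin

interpretation G: wf_digraph "with_proj (comaximal_graph M)"
  by (rule wf_digraph_comaximal)

lemma comaximal_common_neighbour_iff:
  assumes f: "f \<in> comaximal_verts M" and g: "g \<in> comaximal_verts M"
  shows "(\<exists>h. (f, h) \<in> parcs (comaximal_graph M) \<and> (h, g) \<in> parcs (comaximal_graph M))
    \<longleftrightarrow> emeasure M (space M - (zero_set M f \<union> zero_set M g)) > 0" (is "?L \<longleftrightarrow> ?R")
proof
  have [measurable]: "zero_set M f \<in> sets M" "zero_set M g \<in> sets M"
    using f g by (auto simp: comaximal_verts_def)
  show ?R if L: ?L
  proof (rule ccontr)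
    assume "\<not> ?R"
    then have "space M - (zero_set M f \<union> zero_set M g) \<in> null_sets M" by auto
    moreover obtain h where h: "h \<in> comaximal_verts M"
      "emeasure M (zero_set M f \<inter> zero_set M h) = 0" "emeasure M (zero_set M h \<inter> zero_set M g) = 0"
      using L by (auto simp: comaximal_arc_iff)
    have [measurable]: "zero_set M h \<in> sets M"
      using h by (auto simp: comaximal_verts_def)
    have "zero_set M f \<inter> zero_set M h \<in> null_sets M" "zero_set M h \<inter> zero_set M g \<in> null_sets M"
      using h by auto
    \<comment> \<open>These three null sets cover \<open>zero_set M h\<close>, which has positive
      measure because \<open>h\<close> is a vertex.\<close>
    ultimately have "(zero_set M f \<inter> zero_set M h \<union> zero_set M h \<inter> zero_set M g) \<union>
        (space M - (zero_set M f \<union> zero_set M g)) \<in> null_sets M"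
      by (intro null_sets.Un)
    then have "zero_set M h \<in> null_sets M"
      by (rule null_sets_subset[OF _ \<open>zero_set M h \<in> sets M\<close>]) (auto simp: zero_set_def)
    with h(1) show False by (auto simp: comaximal_verts_def)
  qed
  show ?L if ?R
  proof (intro exI conjI)
    let ?A = "zero_set M f \<union> zero_set M g"
    \<comment> \<open>The indicator of \<open>?A\<close> vanishes exactly outside both zero sets. It
      is a vertex because \<open>?A\<close> contains the non-null \<open>zero_set M f\<close> and
      its complement is non-null by assumption.\<close>
    have "emeasure M (zero_set M f) \<le> emeasure M ?A"
      by (intro emeasure_mono) auto
    then have "(\<lambda>x\<in>space M. indicator ?A x) \<in> comaximal_verts M"
      using f that by (intro indicator_in_comaximal_verts) (auto simp: comaximal_verts_def)
    moreover have "zero_set M f \<inter> (space M - ?A) = {}" "(space M - ?A) \<inter> zero_set M g = {}"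
      by auto
    ultimately show "(f, \<lambda>x\<in>space M. indicator ?A x) \<in> parcs (comaximal_graph M)"
      "(\<lambda>x\<in>space M. indicator ?A x, g) \<in> parcs (comaximal_graph M)"
      using f g by (auto simp: comaximal_arc_iff zero_set_indicator)
  qed
qed

lemma comaximal_dist_le_1:
  assumes "(f, g) \<in> parcs (comaximal_graph M)"
  shows "graph_dist (with_proj (comaximal_graph M)) f g \<le> 1"
  using G.graph_dist_le_length[of f "[(f, g)]" g] assms
  by (auto simp: G.awalk_Cons_iff G.awalk_Nil_iff comaximal_arc_iff pverts_comaximal_graph one_enat_def)

lemma comaximal_dist_le_2:
  assumes "(f, h) \<in> parcs (comaximal_graph M)" "(h, g) \<in> parcs (comaximal_graph M)"
  shows "graph_dist (with_proj (comaximal_graph M)) f g \<le> 2"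
  using G.graph_dist_le_length[of f "[(f, h), (h, g)]" g] assms
  by (auto simp: G.awalk_Cons_iff G.awalk_Nil_iff comaximal_arc_iff pverts_comaximal_graph numeral_eq_enat eval_nat_numeral)

lemma comaximal_dist_le_3:
  assumes f: "f \<in> comaximal_verts M" and g: "g \<in> comaximal_verts M"
  shows "graph_dist (with_proj (comaximal_graph M)) f g \<le> 3"
proof (cases "emeasure M (space M - (zero_set M f \<union> zero_set M g)) > 0")
  case True
  then have "graph_dist (with_proj (comaximal_graph M)) f g \<le> 2"
    using comaximal_common_neighbour_iff[OF f g] comaximal_dist_le_2 by blast
  also have "\<dots> \<le> 3" by (simp add: numeral_eq_enat)
  finally show ?thesis .
next
  case False
  \<comment> \<open>The zero sets of \<open>h\<close> and \<open>k\<close> are the complements of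
    those of \<open>f\<close> and \<open>g\<close>. They meet in the complement of the union, which
    is null in this case, so \<open>f\<close>, \<open>h\<close>, \<open>k\<close>, \<open>g\<close>
    is a walk.\<close>
  define h k where "h = (\<lambda>x\<in>space M. indicator (zero_set M f) x :: real)"
    and "k = (\<lambda>x\<in>space M. indicator (zero_set M g) x :: real)"
  have "(\<lambda>x\<in>space M. indicator (zero_set M e) x) \<in> comaximal_verts M"
    if "e \<in> comaximal_verts M" for e
    using that by (intro indicator_in_comaximal_verts) (auto simp: comaximal_verts_def)
  then have "h \<in> comaximal_verts M" "k \<in> comaximal_verts M"
    unfolding h_def k_def using f g by blast+
  moreover have "zero_set M f \<inter> (space M - zero_set M f) = {}"
    "(space M - zero_set M g) \<inter> zero_set M g = {}"
    "(space M - zero_set M f) \<inter> (space M - zero_set M g) = space M - (zero_set M f \<union> zero_set M g)"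
    by auto
  ultimately have "(f, h) \<in> parcs (comaximal_graph M)" "(h, k) \<in> parcs (comaximal_graph M)"
    "(k, g) \<in> parcs (comaximal_graph M)"
    using f g False by (auto simp: comaximal_arc_iff zero_set_indicator h_def k_def)
  then show ?thesis
    using G.graph_dist_le_length[of f "[(f, h), (h, k), (k, g)]" g] 
    by (auto simp: G.awalk_Cons_iff G.awalk_Nil_iff comaximal_arc_iff pverts_comaximal_graph numeral_eq_enat eval_nat_numeral)
qed

lemma comaximal_dist_ge_2:
  assumes "f \<noteq> g" "(f, g) \<notin> parcs (comaximal_graph M)"
  shows "graph_dist (with_proj (comaximal_graph M)) f g \<ge> 2"
  unfolding graph_dist_def
proof (rule INF_greatest, clarify)
  fix p assume "G.apath f p g"
  then have "G.awalk f p g" by (rule G.awalkI_apath)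
  with assms show "2 \<le> enat (length p)"
    \<comment> \<open>The empty walk would force \<open>f = g\<close>, and a single arc would make
      \<open>f\<close> and \<open>g\<close> adjacent.\<close>
    by (cases p; cases "tl p") (auto simp: G.awalk_Cons_iff G.awalk_Nil_iff numeral_eq_enat eval_nat_numeral)
qed

lemma comaximal_dist_ge_3:
  assumes "f \<noteq> g" "(f, g) \<notin> parcs (comaximal_graph M)"
    and "\<And>h. (f, h) \<in> parcs (comaximal_graph M) \<Longrightarrow> (h, g) \<notin> parcs (comaximal_graph M)"
  shows "graph_dist (with_proj (comaximal_graph M)) f g \<ge> 3"
  unfolding graph_dist_def
proof (rule INF_greatest, clarify)
  fix p assume "G.apath f p g"
  then have "G.awalk f p g" by (rule G.awalkI_apath)
  with assms show "3 \<le> enat (length p)"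
    by (cases p; cases "tl p"; cases "tl (tl p)")
      (auto simp: G.awalk_Cons_iff G.awalk_Nil_iff numeral_eq_enat eval_nat_numeral)
qed

section \<open>The eccentricity in the two cases\<close>

lemma eccentricity_atom:
  assumes f: "f \<in> comaximal_verts M" and atom: "measure_atom M (zero_set M f)"
  shows "eccentricity (with_proj (comaximal_graph M)) f = 2"
  unfolding eccentricity_def
proof (rule antisym)
  have verts: "verts (with_proj (comaximal_graph M)) = comaximal_verts M"
    by (simp add: pverts_comaximal_graph)
  have [measurable]: "zero_set M f \<in> sets M"
    using f by (auto simp: comaximal_verts_def)
  show "(SUP g\<in>verts (with_proj (comaximal_graph M)).
      graph_dist (with_proj (comaximal_graph M)) f g) \<le> 2"
    unfolding verts
  proof (rule SUP_least)
    fix g assume g: "g \<in> comaximal_verts M"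
    then have [measurable]: "zero_set M g \<in> sets M"
      by (auto simp: comaximal_verts_def)
    show "graph_dist (with_proj (comaximal_graph M)) f g \<le> 2"
    proof (cases "(f, g) \<in> parcs (comaximal_graph M)")
      case True
      then have "graph_dist (with_proj (comaximal_graph M)) f g \<le> 1"
        by (rule comaximal_dist_le_1)
      also have "\<dots> \<le> 2" by (simp add: numeral_eq_enat one_enat_def)
      finally show ?thesis .
    next
      case False
      then have "emeasure M (zero_set M f \<inter> zero_set M g) > 0"
        using f g by (auto simp: comaximal_arc_iff zero_less_iff_neq_zero)
      moreover have "zero_set M f = (zero_set M f \<inter> zero_set M g) \<union> (zero_set M f - zero_set M g)"
        "(zero_set M f \<inter> zero_set M g) \<inter> (zero_set M f - zero_set M g) = {}"
        by auto
      moreover have "zero_set M f \<inter> zero_set M g \<in> sets M" "zero_set M f - zero_set M g \<in> sets M"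
        by measurable
      \<comment> \<open>The atom is cut along \<open>zero_set M g\<close>; the inner piece is
        non-null by non-adjacency, so the outer one is null. This includes
        \<open>g = f\<close>.\<close>
      ultimately have "\<not> emeasure M (zero_set M f - zero_set M g) > 0"
        using atom unfolding measure_atom_def by blast
      then have null: "zero_set M f - zero_set M g \<in> null_sets M"
        by auto
      \<comment> \<open>Up to a null set this is the complement of \<open>zero_set M g\<close>,
        which is non-null since \<open>g\<close> is a vertex; hence a common neighbour
        exists.\<close>
      have "space M - (zero_set M f \<union> zero_set M g)
          = (space M - zero_set M g) - (zero_set M f - zero_set M g)"
        by auto
      then have "emeasure M (space M - (zero_set M f \<union> zero_set M g)) = emeasure M (space M - zero_set M g)"
        using null by (simp add: emeasure_Diff_null_set)
      then show ?thesis
        using g comaximal_common_neighbour_iff[OF f g] comaximal_dist_le_2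
        by (auto simp: comaximal_verts_def)
    qed
  qed
  \<comment> \<open>Doubling keeps the zero set, which rules out adjacency to \<open>f\<close>, and
    changes every nonzero value.\<close>
  define g where "g = (\<lambda>x\<in>space M. 2 * f x)"
  have Z: "zero_set M g = zero_set M f"
    by (auto simp: g_def zero_set_def)
  have g: "g \<in> comaximal_verts M"
  proof -
    have "g \<in> carrier (measurable_ring M)"
      using f by (auto simp: comaximal_verts_def carrier_measurable_ring g_def cong: measurable_cong)
    with f show ?thesis
      by (simp add: comaximal_verts_def Z)
  qed
  have "space M - zero_set M f \<noteq> {}"
    using f unfolding comaximal_verts_def by force
  then obtain x where "x \<in> space M" "f x \<noteq> 0"
    by (auto simp: zero_set_def)
  then have "g x \<noteq> f x" by (simp add: g_def)
  then have "f \<noteq> g" by auto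
  moreover have "(f, g) \<notin> parcs (comaximal_graph M)"
    using f by (auto simp: comaximal_arc_iff Z comaximal_verts_def)
  ultimately have "2 \<le> graph_dist (with_proj (comaximal_graph M)) f g"
    by (rule comaximal_dist_ge_2)
  also have "\<dots> \<le> (SUP g\<in>verts (with_proj (comaximal_graph M)).
      graph_dist (with_proj (comaximal_graph M)) f g)"
    unfolding verts by (rule SUP_upper[OF g])
  finally show "2 \<le> (SUP g\<in>verts (with_proj (comaximal_graph M)).
      graph_dist (with_proj (comaximal_graph M)) f g)" .
qed

lemma eccentricity_not_atom:
  assumes f: "f \<in> comaximal_verts M" and not_atom: "\<not> measure_atom M (zero_set M f)"
  shows "eccentricity (with_proj (comaximal_graph M)) f = 3"
  unfolding eccentricity_def
proof (rule antisym)
  have verts: "verts (with_proj (comaximal_graph M)) = comaximal_verts M"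
    by (simp add: pverts_comaximal_graph)
  show "(SUP g\<in>verts (with_proj (comaximal_graph M)).
      graph_dist (with_proj (comaximal_graph M)) f g) \<le> 3"
    unfolding verts by (rule SUP_least) (rule comaximal_dist_le_3[OF f])
  obtain B C where BC: "B \<in> sets M" "C \<in> sets M" "zero_set M f = B \<union> C" "B \<inter> C = {}"
    "emeasure M B > 0" "emeasure M C > 0"
    using not_atom f sets_zero_set[of f M] unfolding measure_atom_def comaximal_verts_def by blast
  \<comment> \<open>The zero set of \<open>g\<close> is the complement of \<open>C\<close>. It meets
    \<open>zero_set M f\<close> in the non-null \<open>B\<close>, so there is no arc; together they
    cover the space because \<open>C\<close> lies in \<open>zero_set M f\<close>, so there is no
    common neighbour.\<close>
  define g where "g = (\<lambda>x\<in>space M. indicator C x :: real)"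
  have Z: "zero_set M g = space M - C"
    by (simp add: g_def zero_set_indicator)
  have "B \<subseteq> space M - C"
    using BC sets.sets_into_space by blast
  then have "emeasure M B \<le> emeasure M (space M - C)"
    using BC by (intro emeasure_mono) auto
  then have g: "g \<in> comaximal_verts M"
    unfolding g_def using BC by (intro indicator_in_comaximal_verts) auto
  have "zero_set M f \<inter> zero_set M g = B"
    using \<open>B \<subseteq> space M - C\<close> BC by (auto simp: Z)
  then have "(f, g) \<notin> parcs (comaximal_graph M)"
    using BC by (auto simp: comaximal_arc_iff)
  moreover have "space M - (zero_set M f \<union> zero_set M g) = {}"
    using BC by (auto simp: Z)
  then have "\<not> (\<exists>h. (f, h) \<in> parcs (comaximal_graph M) \<and> (h, g) \<in> parcs (comaximal_graph M))"
    unfolding comaximal_common_neighbour_iff[OF f g] by (simp only: emeasure_empty)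
  moreover have "f \<noteq> g"
  proof
    \<comment> \<open>Then \<open>zero_set M f\<close> alone would be the whole space, contrary to
      \<open>f\<close> being a vertex.\<close>
    assume "f = g"
    then have "space M - zero_set M f = {}"
      using \<open>space M - (zero_set M f \<union> zero_set M g) = {}\<close> by simp
    with f show False by (simp add: comaximal_verts_def)
  qed
  ultimately have "3 \<le> graph_dist (with_proj (comaximal_graph M)) f g"
    by (intro comaximal_dist_ge_3) auto
  also have "\<dots> \<le> (SUP g\<in>verts (with_proj (comaximal_graph M)).
      graph_dist (with_proj (comaximal_graph M)) f g)"
    unfolding verts by (rule SUP_upper[OF g])
  finally show "3 \<le> (SUP g\<in>verts (with_proj (comaximal_graph M)).
      graph_dist (with_proj (comaximal_graph M)) f g)" .
qed

end

theorem theorem3p13: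
  fixes M :: "'a measure" and f :: "'a \<Rightarrow> real"
  assumes "emeasure M (space M) > 0"
    and "\<not> measure_atom M (space M)"
    and "f \<in> pverts (comaximal_graph M)"
  shows "eccentricity (with_proj (comaximal_graph M)) f
    = (if measure_atom M (zero_set M f) then 2 else 3)"
proof -
  have "f \<in> comaximal_verts M"
    using assms(3) by (simp add: comaximal_graph_def)
  then show ?thesis
    by (simp add: eccentricity_atom eccentricity_not_atom)
qed

end
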